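(* For all integers $d \geq 4$ and all $\lambda \in \Gamma_d$, consider the proper polynomial map $f_{d,\lambda} \colon \mathbb{C}^2 \longrightarrow \mathbb{C}^2$ defined by $$f_{d,\lambda}(x,y) := (x,\, Q_{d,\lambda}(x,y)), \qquad Q_{d,\lambda}(x,y) := \frac{1}{d+1}\,y^{d+1} + \frac{\lambda}{2}\,x^{d-1}y^2 + x^d y .$$ If $\lambda, \mu \in \Gamma_d$ and $\lambda^d \neq \mu^d$, then $f_{d,\lambda}$ and $f_{d,\mu}$ are not equivalent. In particular, for all $d \geq 4$ there exists a continuous family of proper polynomial maps $\mathbb{C}^2 \longrightarrow \mathbb{C}^2$ of degree $d$ whose members are pairwise non-equivalent.
   Context: A dominant polynomial map $f \colon \mathbb{C}^n \longrightarrow \mathbb{C}^n$ is called proper if for every compact set $K \subset \mathbb{C}^n$ the set $f^{-1}(K)$ is compact. For a proper polynomial map $f$, let $J_f$ be the determinant of its Jacobian matrix, let $\mathrm{Crit}(f) = V(J_f)$ be the critical locus (the zero set of $J_f$), and let $B(f) = f(\mathrm{Crit}(f))$ be the branch locus; the restriction $f \colon \mathbb{C}^n \setminus f^{-1}(B(f)) \longrightarrow \mathbb{C}^n \setminus B(f)$ is an unramified covering of finite degree, called the topological degree of $f$. The degree of a proper polynomial map means its topological degree. $\mathrm{Aut}(\mathbb{C}^n)$ denotes the group of polynomial automorphisms of $\mathbb{C}^n$. Two proper polynomial maps $f_1, f_2 \colon \mathbb{C}^n \longrightarrow \mathbb{C}^n$ are called equivalent if there exist $\Phi_1, \Phi_2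 \in \mathrm{Aut}(\mathbb{C}^n)$ such that $f_2 = \Phi_2 \circ f_1 \circ \Phi_1$. For $d \in \mathbb{N}$ and $\lambda \in \mathbb{C}$ set $F_{d,\lambda}(x,y) := y^d + \lambda x^{d-1}y + x^d$, and let $\Gamma_d$ be the set of all $\lambda \in \mathbb{C}$ such that $F_{d,\lambda}(x,y)$ is square-free, i.e. is the product of $d$ pairwise distinct homogeneous linear factors. The set $\mathbb{C} \setminus \Gamma_d$ is finite. "Continuous family" is meant as opposed to a discrete family: the members depend on a continuously varying parameter. *)

theory Defs
  imports "HOL-Analysis.Analysis" "HOL-Computational_Algebra.Computational_Algebra"
begin

text \<open>Polynomials in the coordinates are identified with the functions they induce, which loses
  nothing over the infinite field of complex numbers. Exponent vectors are functions on the
  coordinate index type.\<close>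

definition monomial_fun :: "('n::finite \<Rightarrow> nat) \<Rightarrow> complex ^ 'n \<Rightarrow> complex" where
  "monomial_fun \<alpha> v = (\<Prod>i\<in>UNIV. (v $ i) ^ \<alpha> i)"

definition polynomial_fun :: "(complex ^ 'n::finite \<Rightarrow> complex) \<Rightarrow> bool" where
  "polynomial_fun p \<longleftrightarrow>
     (\<exists>S c. finite S \<and> (\<forall>v. p v = (\<Sum>\<alpha>\<in>S. c \<alpha> * monomial_fun \<alpha> v)))"

definition polynomial_map :: "(complex ^ 'n::finite \<Rightarrow> complex ^ 'n) \<Rightarrow> bool" where
  "polynomial_map f \<longleftrightarrow> (\<forall>i. polynomial_fun (\<lambda>v. f v $ i))"

text \<open>Zariski density of the image: no nonzero polynomial vanishes on it.\<close>

definition dominant :: "(complex ^ 'n::finite \<Rightarrow> complex ^ 'n) \<Rightarrow> bool" where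
  "dominant f \<longleftrightarrow>
     (\<forall>p. polynomial_fun p \<longrightarrow> (\<forall>v. p (f v) = 0) \<longrightarrow> (\<forall>w. p w = 0))"

definition proper_polynomial_map :: "(complex ^ 'n::finite \<Rightarrow> complex ^ 'n) \<Rightarrow> bool" where
  "proper_polynomial_map f \<longleftrightarrow>
     polynomial_map f \<and> dominant f \<and> (\<forall>K. compact K \<longrightarrow> compact (f -` K))"

text \<open>The library constant \<open>jacobian\<close> is the real one; here the entries are the complex partial
  derivatives, and the determinant is taken over the complex numbers.\<close>

definition jacobian_det :: "(complex ^ 'n::finite \<Rightarrow> complex ^ 'n) \<Rightarrow> complex ^ 'n \<Rightarrow> complex" where
  "jacobian_det f v = det (\<chi> i j. deriv (\<lambda>t. f (v + t *s axis j 1) $ i) 0)"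

definition critical_locus :: "(complex ^ 'n::finite \<Rightarrow> complex ^ 'n) \<Rightarrow> (complex ^ 'n) set" where
  "critical_locus f = {v. jacobian_det f v = 0}"

definition branch_locus :: "(complex ^ 'n::finite \<Rightarrow> complex ^ 'n) \<Rightarrow> (complex ^ 'n) set" where
  "branch_locus f = f ` critical_locus f"

text \<open>The degree of the covering over the complement of the branch locus, as its number of sheets:
  every fibre over that complement has exactly \<open>k\<close> points. The complement is required to be nonempty
  so that \<open>k\<close> is determined by \<open>f\<close>, and finiteness is explicit because \<open>card\<close> is 0 on infinite
  sets.\<close>

definition has_topological_degree ::
    "(complex ^ 'n::finite \<Rightarrow> complex ^ 'n) \<Rightarrow> nat \<Rightarrow> bool" where
  "has_topological_degree f k \<longleftrightarrow>
     branch_locus f \<noteq> UNIV \<and>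
     (\<forall>w. w \<notin> branch_locus f \<longrightarrow> finite (f -` {w}) \<and> card (f -` {w}) = k)"

definition polynomial_automorphism :: "(complex ^ 'n::finite \<Rightarrow> complex ^ 'n) \<Rightarrow> bool" where
  "polynomial_automorphism \<Phi> \<longleftrightarrow>
     polynomial_map \<Phi> \<and> (\<exists>\<Psi>. polynomial_map \<Psi> \<and> \<Phi> \<circ> \<Psi> = id \<and> \<Psi> \<circ> \<Phi> = id)"

definition equivalent_maps ::
    "(complex ^ 'n::finite \<Rightarrow> complex ^ 'n) \<Rightarrow> (complex ^ 'n \<Rightarrow> complex ^ 'n) \<Rightarrow> bool" where
  "equivalent_maps f\<^sub>1 f\<^sub>2 \<longleftrightarrow>
     (\<exists>\<Phi>\<^sub>1 \<Phi>\<^sub>2. polynomial_automorphism \<Phi>\<^sub>1 \<and> polynomial_automorphism \<Phi>\<^sub>2 \<and>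
        f\<^sub>2 = \<Phi>\<^sub>2 \<circ> f\<^sub>1 \<circ> \<Phi>\<^sub>1)"

text \<open>A family of polynomial maps over a nonempty connected open set \<open>U\<close> of complex parameters: the
  monomials that may occur are fixed and finite in number, and their vector coefficients depend
  continuously on the parameter.\<close>

definition continuous_polynomial_family ::
    "complex set \<Rightarrow> (complex \<Rightarrow> complex ^ 'n::finite \<Rightarrow> complex ^ 'n) \<Rightarrow> bool" where
  "continuous_polynomial_family U g \<longleftrightarrow>
     open U \<and> connected U \<and> U \<noteq> {} \<and>
     (\<exists>S c. finite S \<and> (\<forall>\<alpha>\<in>S. continuous_on U (c \<alpha>)) \<and>
        (\<forall>t\<in>U. \<forall>v. g t v = (\<Sum>\<alpha>\<in>S. monomial_fun \<alpha> v *s c \<alpha> t)))"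

text \<open>\<open>F_poly d l\<close> is $y^d + l x^{d-1} y + x^d$ with \<open>y\<close> as the outer and \<open>x\<close> as the inner
  variable of \<open>complex poly poly\<close>. It is homogeneous, so being squarefree in this ring
  means being a product of \<open>d\<close> pairwise non-proportional linear forms.\<close>

definition F_poly :: "nat \<Rightarrow> complex \<Rightarrow> complex poly poly" where
  "F_poly d l = monom 1 d + monom (monom l (d - 1)) 1 + monom (monom 1 d) 0"

definition Gamma_set :: "nat \<Rightarrow> complex set" where
  "Gamma_set d = {l. squarefree (F_poly d l)}"

definition Q_fun :: "nat \<Rightarrow> complex \<Rightarrow> complex \<Rightarrow> complex \<Rightarrow> complex" where
  "Q_fun d l x y =
     1 / of_nat (d + 1) * y ^ (d + 1) + l / 2 * x ^ (d - 1) * y ^ 2 + x ^ d * y"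

definition f_map :: "nat \<Rightarrow> complex \<Rightarrow> complex ^ 2 \<Rightarrow> complex ^ 2" where
  "f_map d l v = vector [v $ 1, Q_fun d l (v $ 1) (v $ 2)]"

end

theory Submission
  imports Defs
begin

text \<open>The Jacobian determinant of \<open>f_map n l\<close> is the form
  $F_l = y^n + l x^{n-1} y + x^n$. If $f_m = \Psi \circ f_l \circ \Phi$ with automorphisms
  $\Phi, \Psi$, the chain rule gives $F_m = u \cdot (F_l \circ \Phi)$ with $u$ continuous and
  nowhere zero. As $F_m$ vanishes to order at least 2 at the origin, the gradient of $F_l$ vanishes
  at $\Phi(0)$, and squarefreeness forces $\Phi(0) = 0$. Rescaling $F_m(tw) = t^n F_m(w)$ and letting
  $t \to 0$ shows that $F_m(w) = u(0) F_l(Aw)$ for the Jacobian matrix $A$ of $\Phi$ at $0$.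
  Comparing the Jacobian matrices at $0$ of both sides of $f_m = \Psi \circ f_l \circ \Phi$ makes
  $A$ lower triangular, and comparing coefficients yields $m^n = l^n$.

  The map \<open>f_map n l\<close> has topological degree $n + 1$, so a family of degree $d$ is obtained
  from $n = d - 1 \ge 3$; substituting $l = e^t$, with $t$ in a small disc, makes the powers
  $l^n$ pairwise distinct.\<close>

no_notation fps_nth (infixl \<open>$\<close> 75)

section \<open>Complex derivatives and Jacobian matrices of polynomial maps\<close>

definition jacobian_matrix :: "(complex ^ 'n::finite \<Rightarrow> complex ^ 'n) \<Rightarrow> complex ^ 'n \<Rightarrow> complex ^ 'n ^ 'n" where
  "jacobian_matrix f v = (\<chi> i j. deriv (\<lambda>t. f (v + t *s axis j 1) $ i) 0)"

lemma jacobian_det_eq: "jacobian_det f v = det (jacobian_matrix f v)"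
  by (simp add: jacobian_det_def jacobian_matrix_def)

text \<open>The derivative is a real Frechet derivative, but its prescribed form makes it complex
  linear, with \<open>D v\<close> the vector of complex partial derivatives. Continuity of
  \<open>D\<close> is bundled in because it yields continuity of
  \<open>jacobian_det\<close>.\<close>

definition has_continuous_gradient ::
    "(complex ^ 'n::finite \<Rightarrow> complex) \<Rightarrow> (complex ^ 'n \<Rightarrow> complex ^ 'n) \<Rightarrow> bool" where
  "has_continuous_gradient p D \<longleftrightarrow>
     continuous_on UNIV D \<and> (\<forall>v. (p has_derivative (\<lambda>h. \<Sum>i\<in>UNIV. D v $ i * h $ i)) (at v))"

lemma has_continuous_gradient_const: "has_continuous_gradient (\<lambda>v. c) (\<lambda>v. 0)"
  by (auto simp: has_continuous_gradient_def)

lemma ex_has_continuous_gradient_const: "\<exists>D. has_continuous_gradient (\<lambda>v. c) D"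
  by (rule exI, rule has_continuous_gradient_const)

lemma has_continuous_gradient_component:
  fixes k :: "'n::finite"
  shows "has_continuous_gradient (\<lambda>v. v $ k) (\<lambda>v. axis k 1)"
proof -
  have "(\<Sum>i\<in>UNIV. (axis k 1 :: complex ^ 'n) $ i * h $ i) = h $ k" for h
    by (subst sum.remove[of _ k]) (auto simp: axis_def intro: sum.neutral)
  then show ?thesis
    by (auto simp: has_continuous_gradient_def
        intro!: bounded_linear_imp_has_derivative bounded_linear_vec_nth)
qed

lemma has_continuous_gradient_add:
  assumes "has_continuous_gradient p D" "has_continuous_gradient q E"
  shows "has_continuous_gradient (\<lambda>v. p v + q v) (\<lambda>v. D v + E v)"
  using assms unfolding has_continuous_gradient_def
  by (simp add: continuous_on_add distrib_right sum.distrib has_derivative_add)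

lemma has_continuous_gradient_mult:
  assumes "has_continuous_gradient p D" "has_continuous_gradient q E"
  shows "has_continuous_gradient (\<lambda>v. p v * q v) (\<lambda>v. p v *s E v + q v *s D v)"
proof -
  have p: "(p has_derivative (\<lambda>h. \<Sum>i\<in>UNIV. D v $ i * h $ i)) (at v)"
    and q: "(q has_derivative (\<lambda>h. \<Sum>i\<in>UNIV. E v $ i * h $ i)) (at v)" for v
    using assms by (auto simp: has_continuous_gradient_def)
  have "continuous_on UNIV p" "continuous_on UNIV q"
    using p q by (auto intro!: has_derivative_continuous_on)
  then have "continuous_on UNIV (\<lambda>v. p v *s E v + q v *s D v)"
    using assms unfolding has_continuous_gradient_def vector_scalar_mult_def plus_vec_def
    by (auto intro!: continuous_intros)
  moreover have "((\<lambda>v. p v * q v) has_derivative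
      (\<lambda>h. \<Sum>i\<in>UNIV. (p v *s E v + q v *s D v) $ i * h $ i)) (at v)" for v
  proof -
    have "(\<Sum>i\<in>UNIV. (p v *s E v + q v *s D v) $ i * h $ i) =
        p v * (\<Sum>i\<in>UNIV. E v $ i * h $ i) + (\<Sum>i\<in>UNIV. D v $ i * h $ i) * q v" for h
      by (simp add: sum_distrib_left sum_distrib_right sum.distrib[symmetric] algebra_simps)
    then show ?thesis
      using has_derivative_mult[OF p q, of v] by simp
  qed
  ultimately show ?thesis
    by (simp add: has_continuous_gradient_def)
qed

lemma has_continuous_gradient_power:
  assumes "has_continuous_gradient p D"
  shows "\<exists>E. has_continuous_gradient (\<lambda>v. p v ^ k) E"
proof (induction k)
  case 0
  then show ?case
    using has_continuous_gradient_const by auto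
next
  case (Suc k)
  then show ?case
    using has_continuous_gradient_mult[OF assms] by auto
qed

lemma has_continuous_gradient_prod:
  assumes "\<And>i. i \<in> A \<Longrightarrow> \<exists>D. has_continuous_gradient (p i) D"
  shows "\<exists>D. has_continuous_gradient (\<lambda>v. \<Prod>i\<in>A. p i v) D"
  using assms
proof (induction A rule: infinite_finite_induct)
  case (insert i A)
  then obtain D E where "has_continuous_gradient (p i) D"
      "has_continuous_gradient (\<lambda>v. \<Prod>i\<in>A. p i v) E"
    by (metis insertCI)
  from has_continuous_gradient_mult[OF this] show ?case
    using insert.hyps by auto
qed (simp_all add: ex_has_continuous_gradient_const)

lemma has_continuous_gradient_sum:
  assumes "\<And>i. i \<in> A \<Longrightarrow> \<exists>D. has_continuous_gradient (p i) D"
  shows "\<exists>D. has_continuous_gradient (\<lambda>v. \<Sum>i\<in>A. p i v) D"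
  using assms
proof (induction A rule: infinite_finite_induct)
  case (insert i A)
  then obtain D E where "has_continuous_gradient (p i) D"
      "has_continuous_gradient (\<lambda>v. \<Sum>i\<in>A. p i v) E"
    by (metis insertCI)
  from has_continuous_gradient_add[OF this] show ?case
    using insert.hyps by auto
qed (simp_all add: ex_has_continuous_gradient_const)

lemma polynomial_fun_gradient:
  assumes "polynomial_fun p"
  shows "\<exists>D. has_continuous_gradient p D"
proof -
  obtain S c where p: "\<And>v. p v = (\<Sum>\<alpha>\<in>S. c \<alpha> * monomial_fun \<alpha> v)"
    using assms unfolding polynomial_fun_def by blast
  have "\<exists>D. has_continuous_gradient (\<lambda>v. c \<alpha> * monomial_fun \<alpha> v) D" for \<alpha>
  proof -
    have "\<exists>D. has_continuous_gradient (monomial_fun \<alpha>) D"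
      unfolding monomial_fun_def[abs_def]
      by (rule has_continuous_gradient_prod, rule has_continuous_gradient_power,
          rule has_continuous_gradient_component)
    then show ?thesis
      using has_continuous_gradient_mult[OF has_continuous_gradient_const] by blast
  qed
  then have "\<exists>D. has_continuous_gradient (\<lambda>v. \<Sum>\<alpha>\<in>S. c \<alpha> * monomial_fun \<alpha> v) D"
    by (rule has_continuous_gradient_sum)
  then show ?thesis
    by (simp only: p[symmetric])
qed

lemma has_derivative_vec_componentwise:
  fixes f :: "'a::real_normed_vector \<Rightarrow> 'b::euclidean_space ^ 'n::finite"
  assumes "\<And>i. ((\<lambda>x. f x $ i) has_derivative (\<lambda>h. f' h $ i)) (at a)"
  shows "(f has_derivative f') (at a)"
  by (subst has_derivative_componentwise_within)
    (auto simp: Basis_vec_def inner_axis intro!: has_derivative_inner_left assms)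

text \<open>On a complex line, a real derivative given by a complex matrix acts by complex
  multiplication. This links \<open>has_derivative\<close> with the \<open>deriv\<close> in
  \<open>jacobian_matrix\<close>.\<close>

lemma has_field_derivative_along_line:
  fixes f :: "complex ^ 'n::finite \<Rightarrow> complex ^ 'n"
  assumes "(f has_derivative (\<lambda>h. M *v h)) (at v)"
  shows "((\<lambda>t. f (v + t *s w) $ i) has_field_derivative (M *v w) $ i) (at 0)"
proof -
  have l: "bounded_linear (\<lambda>t. t *s w)"
    by (simp add: linear_conv_bounded_linear[symmetric] linear_iff vec_eq_iff algebra_simps)
  have "((\<lambda>t. v + t *s w) has_derivative (\<lambda>t. t *s w)) (at 0)"
    using has_derivative_add[OF has_derivative_const bounded_linear_imp_has_derivative[OF l]]
    by simp
  moreover have "(f has_derivative (\<lambda>h. M *v h)) (at (v + 0 *s w))"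
    using assms by simp
  ultimately have "(f \<circ> (\<lambda>t. v + t *s w) has_derivative (\<lambda>h. M *v h) \<circ> (\<lambda>t. t *s w)) (at 0)"
    by (intro diff_chain_at) simp_all
  then have "((\<lambda>t. f (v + t *s w) $ i) has_derivative (\<lambda>t. (M *v (t *s w)) $ i)) (at 0)"
    by (intro bounded_linear.has_derivative[OF bounded_linear_vec_nth]) (simp add: o_def)
  moreover have "(M *v (t *s w)) $ i = (M *v w) $ i * t" for t
    by (simp add: vec.scale)
  ultimately show ?thesis
    by (simp add: has_field_derivative_def)
qed

lemma jacobian_matrix_eqI:
  assumes "(f has_derivative (\<lambda>h. M *v h)) (at v)"
  shows "jacobian_matrix f v = M"
proof -
  have "((\<lambda>t. f (v + t *s axis j 1) $ i) has_field_derivative M $ i $ j) (at 0)" for i j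
    using has_field_derivative_along_line[OF assms, of "axis j 1" i]
    by (simp add: matrix_vector_mult_def axis_def sum.remove[of UNIV j])
  then show ?thesis
    unfolding jacobian_matrix_def vec_eq_iff by (auto intro!: DERIV_imp_deriv)
qed

lemma polynomial_map_jacobian:
  assumes "polynomial_map f"
  shows "(f has_derivative (\<lambda>h. jacobian_matrix f v *v h)) (at v)"
    and "continuous_on UNIV (jacobian_det f)"
proof -
  have "\<forall>i. \<exists>D. has_continuous_gradient (\<lambda>v. f v $ i) D"
    using assms by (intro allI polynomial_fun_gradient) (simp add: polynomial_map_def)
  then obtain D where D: "\<And>i. has_continuous_gradient (\<lambda>v. f v $ i) (D i)"
    by (auto dest!: choice)
  have der: "(f has_derivative (\<lambda>h. (\<chi> i. D i v) *v h)) (at v)" for v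
    using D by (intro has_derivative_vec_componentwise)
      (auto simp: matrix_vector_mult_def has_continuous_gradient_def)
  have J: "jacobian_matrix f v = (\<chi> i. D i v)" for v
    by (rule jacobian_matrix_eqI[OF der])
  show "(f has_derivative (\<lambda>h. jacobian_matrix f v *v h)) (at v)"
    using der by (simp add: J)
  show "continuous_on UNIV (jacobian_det f)"
  proof -
    have "continuous_on UNIV (D i)" for i
      using D by (simp add: has_continuous_gradient_def)
    then show ?thesis
      unfolding jacobian_det_eq[abs_def] J det_def by (simp add: continuous_intros)
  qed
qed

lemma polynomial_map_continuous: "polynomial_map f \<Longrightarrow> continuous_on UNIV f"
  by (rule has_derivative_continuous_on) (auto intro: polynomial_map_jacobian)

lemma has_derivative_matrix_compose:
  assumes "(f has_derivative (\<lambda>h. A *v h)) (at v)" "(g has_derivative (\<lambda>h. B *v h)) (at (f v))"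
  shows "(g \<circ> f has_derivative (\<lambda>h. (B ** A) *v h)) (at v)"
  using diff_chain_at[OF assms] by (simp add: o_def matrix_vector_mul_assoc)

text \<open>The chain rule for \<open>\<Psi> \<circ> \<Phi> = id\<close> exhibits a left inverse of
  the Jacobian matrix.\<close>

lemma polynomial_automorphism_jacobian_det:
  assumes "polynomial_automorphism \<Phi>"
  shows "jacobian_det \<Phi> v \<noteq> 0"
proof -
  obtain \<Psi> where *: "polynomial_map \<Phi>" "polynomial_map \<Psi>" "\<Psi> \<circ> \<Phi> = id"
    using assms by (auto simp: polynomial_automorphism_def)
  have "jacobian_matrix (id :: complex ^ 'a \<Rightarrow> _) v = mat 1"
    by (rule jacobian_matrix_eqI) (simp add: id_def)
  then have "mat 1 = jacobian_matrix \<Psi> (\<Phi> v) ** jacobian_matrix \<Phi> v"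
    using jacobian_matrix_eqI[OF has_derivative_matrix_compose[OF
        polynomial_map_jacobian(1)[OF *(1)] polynomial_map_jacobian(1)[OF *(2)]], of v] *(3)
    by simp
  then have "det (jacobian_matrix \<Psi> (\<Phi> v)) * det (jacobian_matrix \<Phi> v) = 1"
    by (metis det_I det_mul)
  then show ?thesis
    by (auto simp: jacobian_det_eq)
qed

section \<open>The binary form F_l and its double roots\<close>

definition F_fun :: "nat \<Rightarrow> complex \<Rightarrow> complex \<Rightarrow> complex \<Rightarrow> complex" where
  "F_fun n l x y = y ^ n + l * x ^ (n - 1) * y + x ^ n"

text \<open>\<open>l\<close> fails to be nondegenerate exactly when $y^n + l y + 1$ has a double root \<open>r\<close>: the two
  equations below are $n r^{n-1} + l = 0$ and $r^n + l r + 1 = 0$ with \<open>l\<close> eliminated from the latter.\<close>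

definition nondegenerate :: "nat \<Rightarrow> complex \<Rightarrow> bool" where
  "nondegenerate n l \<longleftrightarrow>
     (\<forall>r. of_nat (n - 1) * r ^ n = 1 \<longrightarrow> l \<noteq> - of_nat n * r ^ (n - 1))"

text \<open>The expression is y^(n+1) minus its tangent line at z, that is y^(n+1) - z^(n+1) - (n+1)
  z^n (y - z). The general ring lets y and z themselves be polynomials.\<close>

lemma square_dvd_double_root:
  fixes y z :: "'a::comm_ring_1"
  shows "(y - z)\<^sup>2 dvd y ^ Suc n - of_nat (Suc n) * z ^ n * y + of_nat n * z ^ Suc n"
proof (induction n)
  case 0
  then show ?case by simp
next
  case (Suc n)
  have "y ^ Suc (Suc n) - of_nat (Suc (Suc n)) * z ^ Suc n * y + of_nat (Suc n) * z ^ Suc (Suc n) =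
      y * (y ^ Suc n - of_nat (Suc n) * z ^ n * y + of_nat n * z ^ Suc n)
      + of_nat (Suc n) * z ^ n * (y - z)\<^sup>2"
    by (simp add: algebra_simps power2_eq_square)
  then show ?case
    using Suc by (metis dvd_add dvd_mult dvd_triv_right)
qed

text \<open>A double root r of y^n + l y + 1 homogenizes to the linear form y - r x, whose square
  divides \<open>F_poly n l\<close>; squarefreeness would make this form a unit.\<close>

lemma Gamma_set_nondegenerate:
  assumes "l \<in> Gamma_set n" "n \<ge> 1"
  shows "nondegenerate n l"
  unfolding nondegenerate_def
proof (intro allI impI notI)
  fix r assume r: "of_nat (n - 1) * r ^ n = 1" and l: "l = - of_nat n * r ^ (n - 1)"
  \<comment> \<open>\<open>Y\<close> is the outer variable y and \<open>z\<close> is r times the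
    inner variable x.\<close>
  define Y z :: "complex poly poly" where "Y = monom 1 1" and "z = monom (monom r 1) 0"
  obtain k where k: "n = Suc k"
    using assms by (cases n) auto
  have z: "of_nat i * z ^ j = monom (monom (of_nat i * r ^ j) j) 0" for i j
    by (simp add: z_def monom_power mult_monom of_nat_monom)
  have "Y ^ Suc k - of_nat (Suc k) * z ^ k * Y + of_nat k * z ^ Suc k = F_poly n l"
  proof -
    have "of_nat (Suc k) * z ^ k * Y = - monom (monom l k) 1"
      unfolding z by (simp add: Y_def k l mult_monom minus_monom algebra_simps)
    moreover have "of_nat k * z ^ Suc k = monom (monom 1 n) 0"
      unfolding z using r by (simp add: k)
    ultimately show ?thesis
      by (simp add: F_poly_def Y_def k monom_power mult_monom)
  qed
  then have "(Y - z)\<^sup>2 dvd F_poly n l"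
    using square_dvd_double_root[of Y z k] by simp
  then have "Y - z dvd 1"
    using assms by (intro squarefreeD) (auto simp: Gamma_set_def)
  then have "degree (Y - z) = 0"
    by (auto dest: dvd_imp_degree_le)
  moreover have "Y - z = [:- monom r 1, 1:]"
    by (simp add: Y_def z_def monom_Suc monom_0)
  ultimately show False
    by simp
qed

text \<open>A double root satisfies (n-1) r^n = 1, hence |r| \<le> 1 and |l| = n |r|^(n-1) \<le> n.
  This supplies explicit parameters for the family.\<close>

lemma nondegenerate_if_large:
  assumes "norm l > of_nat n" "n \<ge> 2"
  shows "nondegenerate n l"
  unfolding nondegenerate_def
proof (intro allI impI notI)
  fix r assume r: "of_nat (n - 1) * r ^ n = 1" and l: "l = - of_nat n * r ^ (n - 1)"
  have "norm r \<le> 1"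
  proof (rule ccontr)
    assume "\<not> norm r \<le> 1"
    then have "norm r ^ n > 1"
      using assms by (intro one_less_power) auto
    moreover have "real (n - 1) * norm r ^ n = 1"
      using arg_cong[OF r, of norm] by (simp add: norm_mult norm_power del: of_nat_diff)
    moreover have "real (n - 1) * norm r ^ n \<ge> 1 * norm r ^ n"
      using assms by (intro mult_right_mono) auto
    ultimately show False
      by simp
  qed
  then have "norm r ^ (n - 1) \<le> 1"
    by (simp add: power_le_one)
  then have "norm l \<le> real n * 1"
    unfolding l by (simp add: norm_mult norm_power mult_left_le)
  then show False
    using assms by simp
qed

text \<open>The two equations say that the partial derivatives of F_l vanish at (x, y). If x is
  nonzero, the slope y/x satisfies the double-root equations excluded by
  \<open>nondegenerate\<close>; if x = 0, the second equation gives y = 0.\<close>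

lemma F_gradient_zero:
  assumes "nondegenerate n l" "n \<ge> 2"
    and x: "l * of_nat (n - 1) * x ^ (n - 2) * y + of_nat n * x ^ (n - 1) = 0"
    and y: "of_nat n * y ^ (n - 1) + l * x ^ (n - 1) = 0"
  shows "x = 0 \<and> y = 0"
proof (cases "x = 0")
  case True
  then show ?thesis
    using y assms(2) by (simp add: power_0_left)
next
  case False
  define r where "r = y / x"
  obtain k where k: "n = Suc (Suc k)"
    using assms(2) by (metis Suc_le_D numeral_2_eq_2 Suc_le_mono)
  have y_eq: "y = r * x"
    using False by (simp add: r_def)
  have "(of_nat n * r ^ (n - 1) + l) * x ^ (n - 1) = 0"
    using y by (simp add: y_eq power_mult_distrib algebra_simps)
  then have l: "l = - of_nat n * r ^ (n - 1)"
    using False by (simp add: eq_neg_iff_add_eq_0 add.commute)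
  have "(l * of_nat (n - 1) * r + of_nat n) * x ^ (n - 1) = 0"
    using x by (simp add: y_eq k algebra_simps)
  then have "l * of_nat (n - 1) * r + of_nat n = 0"
    using False by simp
  moreover have "l * of_nat (n - 1) * r + of_nat n = of_nat n * (1 - of_nat (n - 1) * r ^ n)"
    by (simp add: l k algebra_simps)
  ultimately have "of_nat (n - 1) * r ^ n = 1"
    using assms(2) by simp
  then show ?thesis
    using assms(1) l by (auto simp: nondegenerate_def)
qed

text \<open>F_m has no y^(n-1) term because n \<ge> 3, so the shear coefficient c must vanish; the
  coefficients of y^n, x^n and x^(n-1) y then give C e^n = C a^n = 1 and m = C l a^(n-1) e.\<close>

lemma F_fun_linear_equivalence:
  assumes H: "\<And>x y. F_fun n m x y = C * F_fun n l (a * x) (c * x + e * y)"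
    and "n \<ge> 3" "a \<noteq> 0" "e \<noteq> 0"
  shows "m ^ n = l ^ n"
proof -
  have Ce: "1 = C * e ^ n"
    using H[of 0 1] assms(2) by (simp add: F_fun_def power_0_left)
  have D1: "of_nat n * y ^ (n - 1) + m = C * (of_nat n * (c + e * y) ^ (n - 1) * e + l * a ^ (n - 1) * e)" for y
  proof (rule DERIV_unique)
    show "((\<lambda>y. F_fun n m 1 y) has_field_derivative of_nat n * y ^ (n - 1) + m) (at y)"
      unfolding F_fun_def by (auto intro!: derivative_eq_intros)
    show "((\<lambda>y. F_fun n m 1 y) has_field_derivative
        C * (of_nat n * (c + e * y) ^ (n - 1) * e + l * a ^ (n - 1) * e)) (at y)"
      unfolding H unfolding F_fun_def by (auto intro!: derivative_eq_intros)
  qed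
  have D2: "of_nat n * (of_nat (n - 1) * y ^ (n - 2)) =
      C * (of_nat n * (of_nat (n - 1) * (c + e * y) ^ (n - 2) * e) * e)" for y
  proof (rule DERIV_unique)
    show "((\<lambda>y. of_nat n * y ^ (n - 1) + m) has_field_derivative
        of_nat n * (of_nat (n - 1) * y ^ (n - 2))) (at y)"
      by (auto intro!: derivative_eq_intros simp: diff_diff_left numeral_2_eq_2)
    show "((\<lambda>y. of_nat n * y ^ (n - 1) + m) has_field_derivative
        C * (of_nat n * (of_nat (n - 1) * (c + e * y) ^ (n - 2) * e) * e)) (at y)"
      unfolding D1 by (auto intro!: derivative_eq_intros simp: diff_diff_left numeral_2_eq_2)
  qed
  \<comment> \<open>At y = -c/e the right side of \<open>D2\<close> vanishes, since n - 2 \<ge> 1;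
    the left side is a nonzero multiple of y^(n-2).\<close>
  have "(- c / e) ^ (n - 2) = 0"
    using D2[of "- c / e"] assms by (simp add: power_0_left)
  then have c: "c = 0"
    using assms by simp
  have Ca: "1 = C * a ^ n"
    using H[of 1 0] assms(2) by (simp add: F_fun_def c power_0_left)
  have "m = C * (l * a ^ (n - 1) * e)"
    using D1[of 0] assms(2) by (simp add: c power_0_left)
  \<comment> \<open>With C a^n = 1 this reads m a = l e; taking n-th powers, the factors a^n = e^n
    cancel.\<close>
  then have "m * a = C * a ^ n * (l * e)"
    using assms(2) by (simp add: power_eq_if[of a n])
  then have "m ^ n * a ^ n = l ^ n * e ^ n"
    using Ca by (simp flip: power_mult_distrib)
  moreover have "e ^ n = a ^ n"
    using Ca Ce by (metis mult_cancel_left mult_zero_left zero_neq_one)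
  ultimately show ?thesis
    using assms by simp
qed

section \<open>Derivative of \<open>f_map\<close>\<close>

lemma f_map_components [simp]:
  "f_map n l v $ 1 = v $ 1" "f_map n l v $ 2 = Q_fun n l (v $ 1) (v $ 2)"
  by (simp_all add: f_map_def)

text \<open>The lower row is the gradient of \<open>Q_fun\<close>: in the y-derivative the
  denominators n+1 and 2 cancel the exponents and leave F_l. Truncated exponents in the lower left
  entry are harmless, because the factors \<open>of_nat n\<close> or \<open>of_nat (n - 1)\<close>
  vanish there.\<close>

lemma f_map_has_derivative:
  "(f_map n l has_derivative
     (\<lambda>h. (vector [vector [1, 0],
        vector [l / 2 * of_nat (n - 1) * (v $ 1) ^ (n - 2) * (v $ 2)\<^sup>2 + of_nat n * (v $ 1) ^ (n - 1) * v $ 2,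
          F_fun n l (v $ 1) (v $ 2)]] :: complex ^ 2 ^ 2) *v h)) (at v)"
proof (rule has_derivative_vec_componentwise)
  have nth: "((\<lambda>v :: complex ^ 2. v $ i) has_derivative (\<lambda>h. h $ i)) (at v)" for i
    by (intro bounded_linear_imp_has_derivative bounded_linear_vec_nth)
  have "((\<lambda>v :: complex ^ 2. Q_fun n l (v $ 1) (v $ 2)) has_derivative (\<lambda>h.
     (l / 2 * of_nat (n - 1) * (v $ 1) ^ (n - 2) * (v $ 2)\<^sup>2 + of_nat n * (v $ 1) ^ (n - 1) * v $ 2) * h $ 1 +
     F_fun n l (v $ 1) (v $ 2) * h $ 2)) (at v)"
  proof -
    have a: "1 / complex_of_nat (Suc n) * of_nat (Suc n) = 1"
      by (simp del: of_nat_Suc)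
    have 1: "((\<lambda>v :: complex ^ 2. 1 / of_nat (n + 1) * (v $ 2) ^ (n + 1)) has_derivative
        (\<lambda>h. (v $ 2) ^ n * h $ 2)) (at v)"
      by (rule derivative_eq_intros nth refl)+
        (use a in \<open>simp add: fun_eq_iff del: of_nat_Suc\<close>)
    have 2: "((\<lambda>v :: complex ^ 2. l / 2 * (v $ 1) ^ (n - 1) * (v $ 2)\<^sup>2 + (v $ 1) ^ n * v $ 2) has_derivative
        (\<lambda>h. (l / 2 * of_nat (n - 1) * (v $ 1) ^ (n - 2) * (v $ 2)\<^sup>2 + of_nat n * (v $ 1) ^ (n - 1) * v $ 2) * h $ 1 +
          (l * (v $ 1) ^ (n - 1) * v $ 2 + (v $ 1) ^ n) * h $ 2)) (at v)"
      by (rule derivative_eq_intros nth refl)+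
        (simp add: fun_eq_iff algebra_simps diff_diff_left numeral_2_eq_2 del: of_nat_diff)
    show ?thesis
      unfolding Q_fun_def F_fun_def using has_derivative_add[OF 1 2] by (simp add: algebra_simps)
  qed
  then show "((\<lambda>v. f_map n l v $ i) has_derivative (\<lambda>h. ((vector [vector [1, 0],
        vector [l / 2 * of_nat (n - 1) * (v $ 1) ^ (n - 2) * (v $ 2)\<^sup>2 + of_nat n * (v $ 1) ^ (n - 1) * v $ 2,
          F_fun n l (v $ 1) (v $ 2)]] :: complex ^ 2 ^ 2) *v h) $ i)) (at v)" for i
    using nth[of 1] exhaust_2[of i]
    by (auto simp: matrix_vector_mult_def sum_2)
qed

lemmas f_map_jacobian_matrix = jacobian_matrix_eqI[OF f_map_has_derivative]

lemma f_map_jacobian_det: "jacobian_det (f_map n l) v = F_fun n l (v $ 1) (v $ 2)"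
  by (simp add: jacobian_det_eq f_map_jacobian_matrix det_2)

lemma F_fun_scale: "n \<ge> 1 \<Longrightarrow> F_fun n l (t * x) (t * y) = t ^ n * F_fun n l x y"
  by (cases n) (simp_all add: F_fun_def power_mult_distrib algebra_simps)

section \<open>Rigidity of equivalences between the maps \<open>f_map n l\<close>\<close>

lemma equivalent_f_maps_power_eq:
  assumes "n \<ge> 3" "nondegenerate n l" "equivalent_maps (f_map n l) (f_map n m)"
  shows "m ^ n = l ^ n"
proof -
  obtain \<Phi> \<Psi> where aut: "polynomial_automorphism \<Phi>" "polynomial_automorphism \<Psi>"
    and eq: "f_map n m = \<Psi> \<circ> f_map n l \<circ> \<Phi>"
    using assms(3) by (auto simp: equivalent_maps_def)
  have pol: "polynomial_map \<Phi>" "polynomial_map \<Psi>"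
    using aut by (auto simp: polynomial_automorphism_def)
  define J where "J = jacobian_matrix (f_map n l)"
  have chain: "jacobian_matrix (f_map n m) v =
      jacobian_matrix \<Psi> (f_map n l (\<Phi> v)) ** (J (\<Phi> v) ** jacobian_matrix \<Phi> v)" for v
  proof -
    have "(f_map n l has_derivative (\<lambda>h. J (\<Phi> v) *v h)) (at (\<Phi> v))"
      unfolding J_def f_map_jacobian_matrix by (rule f_map_has_derivative)
    from has_derivative_matrix_compose[OF polynomial_map_jacobian(1)[OF pol(1)] this]
    have "(\<Psi> \<circ> (f_map n l \<circ> \<Phi>) has_derivative (\<lambda>h. (jacobian_matrix \<Psi> (f_map n l (\<Phi> v)) **
        (J (\<Phi> v) ** jacobian_matrix \<Phi> v)) *v h)) (at v)"
      by (rule has_derivative_matrix_compose) (simp add: polynomial_map_jacobian pol)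
    then show ?thesis
      unfolding eq comp_assoc by (rule jacobian_matrix_eqI)
  qed
  define u where "u v = jacobian_det \<Psi> (f_map n l (\<Phi> v)) * jacobian_det \<Phi> v" for v
  have u_nz: "u v \<noteq> 0" for v
    using aut by (simp add: u_def polynomial_automorphism_jacobian_det)
  have F_eq: "F_fun n m (v $ 1) (v $ 2) = u v * F_fun n l (\<Phi> v $ 1) (\<Phi> v $ 2)" for v
    using arg_cong[OF chain, of det]
    by (simp add: u_def J_def det_mul flip: f_map_jacobian_det jacobian_det_eq)
  have f_cont: "continuous_on UNIV (f_map n l)"
    by (rule has_derivative_continuous_on, rule has_derivative_at_withinI, rule f_map_has_derivative)
  have \<Phi>_cont: "continuous_on UNIV \<Phi>"
    by (rule polynomial_map_continuous[OF pol(1)])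
  have f\<Phi>_cont: "continuous_on UNIV (\<lambda>v. f_map n l (\<Phi> v))"
    by (rule continuous_on_compose2[OF f_cont \<Phi>_cont subset_UNIV])
  have "continuous_on UNIV (\<lambda>v. jacobian_det \<Psi> (f_map n l (\<Phi> v)))"
    by (rule continuous_on_compose2[OF polynomial_map_jacobian(2)[OF pol(2)] f\<Phi>_cont subset_UNIV])
  then have u_cont: "continuous_on UNIV u"
    unfolding u_def by (intro continuous_on_mult polynomial_map_jacobian(2)[OF pol(1)])
  have u_lim: "(\<lambda>t. u (t *s w)) \<midarrow>0\<rightarrow> u 0" for w
  proof -
    have "continuous_on UNIV (\<lambda>t. t *s w)"
      unfolding vector_scalar_mult_def by (intro continuous_intros)
    from continuous_on_compose2[OF u_cont this subset_UNIV]
    have "isCont (\<lambda>t. u (t *s w)) 0"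
      by (simp add: continuous_on_eq_continuous_at)
    then show ?thesis
      by (simp add: isCont_def)
  qed
  define A where "A = jacobian_matrix \<Phi> 0"
  have det_A: "det A \<noteq> 0"
    using polynomial_automorphism_jacobian_det[OF aut(1), of 0] by (simp add: A_def jacobian_det_eq)
  have \<Phi>_deriv: "((\<lambda>t. \<Phi> (t *s w) $ i) has_field_derivative (A *v w) $ i) (at 0)" for w i
    using has_field_derivative_along_line[OF polynomial_map_jacobian(1)[OF pol(1)], of 0 w i]
    by (simp add: A_def)
  have line: "t ^ n * F_fun n m (w $ 1) (w $ 2) = u (t *s w) * F_fun n l (\<Phi> (t *s w) $ 1) (\<Phi> (t *s w) $ 2)"
    for t w
    using F_eq[of "t *s w"] assms(1) by (simp add: F_fun_scale)
  define p where "p = \<Phi> 0"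
  let ?gx = "l * of_nat (n - 1) * (p $ 1) ^ (n - 2) * p $ 2 + of_nat n * (p $ 1) ^ (n - 1)"
  let ?gy = "of_nat n * (p $ 2) ^ (n - 1) + l * (p $ 1) ^ (n - 1)"
  \<comment> \<open>The derivative at t = 0 of F_l(\<Phi>(tw)) is computed twice: by the chain rule,
    and as 0 from the factor t^n in \<open>line\<close>.\<close>
  have grad: "?gx * (A *v w) $ 1 + ?gy * (A *v w) $ 2 = 0" for w
  proof (rule DERIV_unique)
    let ?g = "\<lambda>t. F_fun n l (\<Phi> (t *s w) $ 1) (\<Phi> (t *s w) $ 2)"
    show "(?g has_field_derivative ?gx * (A *v w) $ 1 + ?gy * (A *v w) $ 2) (at 0)"
      unfolding F_fun_def
      by (rule derivative_eq_intros \<Phi>_deriv refl)+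
        (simp add: p_def algebra_simps diff_diff_left numeral_2_eq_2 del: of_nat_diff)
    have g: "?g t = t ^ n * F_fun n m (w $ 1) (w $ 2) / u (t *s w)" for t
      using line[of t w] u_nz by (simp add: field_simps)
    \<comment> \<open>The difference quotient uses up one factor t; the remaining t^(n-1) tends to
      0, and \<open>u\<close> enters only through its limit.\<close>
    have "(\<lambda>t. t ^ (n - 1) * F_fun n m (w $ 1) (w $ 2) / u (t *s w)) \<midarrow>0\<rightarrow>
        0 ^ (n - 1) * F_fun n m (w $ 1) (w $ 2) / u 0"
      by (intro tendsto_intros u_lim u_nz)
    moreover have "(?g t - ?g 0) / (t - 0) = t ^ (n - 1) * F_fun n m (w $ 1) (w $ 2) / u (t *s w)"
      if "t \<noteq> 0" for t
      using that assms(1) unfolding g by (simp add: power_0_left power_eq_if[of t n])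
    ultimately show "(?g has_field_derivative 0) (at 0)"
      unfolding has_field_derivative_iff using assms(1)
      by (subst LIM_cong[OF refl _ refl]) (auto simp: power_0_left)
  qed
  \<comment> \<open>Invertibility of \<open>A\<close> lets A w run through both basis vectors, so
    the two partial derivatives of F_l at \<open>p\<close> vanish separately.\<close>
  have surj: "\<exists>w. A *v w = b" for b
  proof -
    obtain B where "A ** B = mat 1"
      using det_A by (auto simp flip: invertible_det_nz simp: invertible_right_inverse)
    then have "A *v (B *v b) = b"
      by (simp add: matrix_vector_mul_assoc)
    then show ?thesis ..
  qed
  have "?gx = 0"
  proof -
    obtain w where "A *v w = axis 1 1"
      using surj by blast
    then show ?thesis
      using grad[of w] by (simp add: axis_def)
  qed
  moreover have "?gy = 0"
  proof -
    obtain w where "A *v w = axis 2 1"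
      using surj by blast
    then show ?thesis
      using grad[of w] by (simp add: axis_def)
  qed
  ultimately have "p $ 1 = 0 \<and> p $ 2 = 0"
    using assms by (intro F_gradient_zero[of n l]) auto
  then have p: "\<Phi> 0 = 0"
    by (simp add: p_def vec_eq_iff forall_2)
  \<comment> \<open>Dividing \<open>line\<close> by t^n moves 1/t inside F_l. The result is constant
    for t \<noteq> 0, while \<Phi>(tw)/t tends to A w because \<Phi>(0) = 0.\<close>
  have F_lin: "F_fun n m (w $ 1) (w $ 2) = u 0 * F_fun n l ((A *v w) $ 1) ((A *v w) $ 2)" for w
  proof (rule tendsto_unique)
    have lim: "(\<lambda>t. \<Phi> (t *s w) $ i / t) \<midarrow>0\<rightarrow> (A *v w) $ i" for i
      using \<Phi>_deriv[of w i] by (simp add: has_field_derivative_iff p)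
    show "(\<lambda>t. u (t *s w) * F_fun n l (\<Phi> (t *s w) $ 1 / t) (\<Phi> (t *s w) $ 2 / t)) \<midarrow>0\<rightarrow>
        u 0 * F_fun n l ((A *v w) $ 1) ((A *v w) $ 2)"
      unfolding F_fun_def by (intro tendsto_intros u_lim lim)
    have "F_fun n m (w $ 1) (w $ 2) =
        u (t *s w) * F_fun n l (\<Phi> (t *s w) $ 1 / t) (\<Phi> (t *s w) $ 2 / t)" if "t \<noteq> 0" for t
      using line[of t w] that assms(1)
        F_fun_scale[of n l t "\<Phi> (t *s w) $ 1 / t" "\<Phi> (t *s w) $ 2 / t"] by simp
    then show "(\<lambda>t. u (t *s w) * F_fun n l (\<Phi> (t *s w) $ 1 / t) (\<Phi> (t *s w) $ 2 / t)) \<midarrow>0\<rightarrow>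
        F_fun n m (w $ 1) (w $ 2)"
      by (subst LIM_cong[OF refl _ refl, where g = "\<lambda>t. F_fun n m (w $ 1) (w $ 2)"]) auto
  qed simp
  define B where "B = jacobian_matrix \<Psi> (f_map n l 0)"
  \<comment> \<open>At the origin the derivative is the projection to the first coordinate for every
    parameter \<open>k\<close>, so the chain rule there constrains only \<open>A\<close> and
    \<open>B\<close>.\<close>
  have f0: "jacobian_matrix (f_map n k) 0 = vector [vector [1, 0], vector [0, 0]]" for k
    using assms(1) by (simp add: f_map_jacobian_matrix F_fun_def power_0_left)
  have "vector [vector [1, 0], vector [0, 0]] = B ** (vector [vector [1, 0], vector [0, 0]] ** A)"
    using chain[of 0] by (simp add: p J_def f0 A_def B_def)
  \<comment> \<open>This is the first row of the matrix identity; the first equation makes the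
    corner entry of \<open>B\<close> nonzero.\<close>
  then have "B $ 1 $ 1 * A $ 1 $ 1 = 1" "B $ 1 $ 1 * A $ 1 $ 2 = 0"
    by (auto simp: vec_eq_iff forall_2 matrix_matrix_mult_def sum_2)
  then have A12: "A $ 1 $ 2 = 0"
    by auto
  show ?thesis
  proof (rule F_fun_linear_equivalence)
    show "F_fun n m x y = u 0 * F_fun n l (A $ 1 $ 1 * x) (A $ 2 $ 1 * x + A $ 2 $ 2 * y)" for x y
      using F_lin[of "vector [x, y]"] by (simp add: matrix_vector_mult_def sum_2 A12)
    show "A $ 1 $ 1 \<noteq> 0" "A $ 2 $ 2 \<noteq> 0"
      using det_A by (auto simp: det_2 A12)
  qed (fact assms(1))
qed

section \<open>Monomial expansion of \<open>f_map\<close>\<close>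

definition exponents :: "nat \<Rightarrow> nat \<Rightarrow> 2 \<Rightarrow> nat" where
  "exponents i j = (\<lambda>k. if k = 1 then i else j)"

lemma exponents_eq_iff [simp]: "exponents i j = exponents i' j' \<longleftrightarrow> i = i' \<and> j = j'"
  by (auto simp: exponents_def fun_eq_iff forall_2)

lemma monomial_fun_exponents: "monomial_fun (exponents i j) v = (v $ 1) ^ i * (v $ 2) ^ j"
  by (simp add: monomial_fun_def exponents_def UNIV_2)

definition f_support :: "nat \<Rightarrow> (2 \<Rightarrow> nat) set" where
  "f_support n = {exponents 1 0, exponents 0 (n + 1), exponents (n - 1) 2, exponents n 1}"

definition f_coeff :: "nat \<Rightarrow> complex \<Rightarrow> (2 \<Rightarrow> nat) \<Rightarrow> complex ^ 2" where
  "f_coeff n l \<alpha> =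
     (if \<alpha> = exponents 1 0 then axis 1 1
      else if \<alpha> = exponents 0 (n + 1) then axis 2 (1 / of_nat (n + 1))
      else if \<alpha> = exponents (n - 1) 2 then axis 2 (l / 2)
      else axis 2 1)"

text \<open>For n \<ge> 2 the four exponents in \<open>f_support n\<close> are distinct, so each
  branch of \<open>f_coeff\<close> contributes exactly its own monomial.\<close>

lemma f_map_expansion:
  assumes "n \<ge> 2"
  shows "f_map n l v = (\<Sum>\<alpha>\<in>f_support n. monomial_fun \<alpha> v *s f_coeff n l \<alpha>)"
  using assms
  by (simp add: vec_eq_iff forall_2 f_support_def f_coeff_def monomial_fun_exponents axis_def
      Q_fun_def)

lemma polynomial_map_expansion:
  assumes "finite S" "\<And>v. f v = (\<Sum>\<alpha>\<in>S. monomial_fun \<alpha> v *s c \<alpha>)"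
  shows "polynomial_map f"
  unfolding polynomial_map_def polynomial_fun_def
proof (intro allI exI conjI)
  show "f v $ i = (\<Sum>\<alpha>\<in>S. c \<alpha> $ i * monomial_fun \<alpha> v)" for v i
    by (simp add: assms(2) mult.commute)
qed (fact assms(1))

lemma polynomial_map_f_map: "n \<ge> 2 \<Longrightarrow> polynomial_map (f_map n l)"
  by (rule polynomial_map_expansion[OF _ f_map_expansion]) (simp_all add: f_support_def)

section \<open>Fibres and topological degree\<close>

definition fibre_poly :: "nat \<Rightarrow> complex \<Rightarrow> complex ^ 2 \<Rightarrow> complex poly" where
  "fibre_poly n l w = monom (1 / of_nat (n + 1)) (n + 1) +
     (monom (l / 2 * (w $ 1) ^ (n - 1)) 2 + monom ((w $ 1) ^ n) 1 - [:w $ 2:])"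

lemma poly_fibre_poly: "poly (fibre_poly n l w) y = Q_fun n l (w $ 1) y - w $ 2"
  by (simp add: fibre_poly_def Q_fun_def poly_monom)

lemma degree_fibre_poly:
  assumes "n \<ge> 2"
  shows "degree (fibre_poly n l w) = n + 1"
proof -
  have "degree (monom (1 / complex_of_nat (n + 1)) (n + 1)) = n + 1"
    by (intro degree_monom_eq) (simp del: of_nat_Suc)
  moreover have "degree (monom (l / 2 * (w $ 1) ^ (n - 1)) 2 + monom ((w $ 1) ^ n) 1 - [:w $ 2:]) \<le> 2"
    by (intro degree_diff_le degree_add_le degree_monom_le[THEN order_trans]) auto
  ultimately show ?thesis
    unfolding fibre_poly_def using assms by (subst degree_add_eq_left) auto
qed

text \<open>Multiple roots of the fibre polynomial thus correspond to critical points of the map in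
  that fibre.\<close>

lemma poly_pderiv_fibre_poly:
  "poly (pderiv (fibre_poly n l w)) y = F_fun n l (w $ 1) y"
proof -
  have "of_nat (n + 1) * (1 / complex_of_nat (n + 1)) = 1"
    by (simp del: of_nat_Suc)
  then show ?thesis
    by (simp add: fibre_poly_def F_fun_def pderiv_add pderiv_diff pderiv_monom pderiv_pCons
        poly_monom del: of_nat_Suc)
qed

lemma f_map_fibre: "f_map n l -` {w} = (\<lambda>y. vector [w $ 1, y]) ` {y. poly (fibre_poly n l w) y = 0}"
proof (intro equalityI subsetI)
  fix v assume "v \<in> f_map n l -` {w}"
  then have "f_map n l v = w"
    by simp
  then have "v = vector [w $ 1, v $ 2]" "poly (fibre_poly n l w) (v $ 2) = 0"
    by (auto simp: vec_eq_iff forall_2 poly_fibre_poly)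
  then show "v \<in> (\<lambda>y. vector [w $ 1, y]) ` {y. poly (fibre_poly n l w) y = 0}"
    by blast
qed (auto simp: vec_eq_iff forall_2 poly_fibre_poly)

text \<open>Each fibre is the root set of a nonconstant complex polynomial, hence nonempty. This
  gives dominance.\<close>

lemma f_map_surj:
  assumes "n \<ge> 2"
  shows "surj (f_map n l)"
proof -
  have "\<exists>v. w = f_map n l v" for w
  proof -
    have "f_map n l -` {w} \<noteq> {}"
      using alg_closed_imp_poly_has_root[of "fibre_poly n l w"] assms
      by (simp add: f_map_fibre degree_fibre_poly)
    then show ?thesis
      by auto
  qed
  then show ?thesis
    unfolding surj_def by (rule allI)
qed

lemma card_roots_rsquarefree:
  fixes p :: "complex poly"
  assumes "rsquarefree p"
  shows "card {z. poly p z = 0} = degree p"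
proof -
  have "p \<noteq> 0"
    using assms by (simp add: rsquarefree_def)
  then have "degree (smult (lead_coeff p) (\<Prod>z | poly p z = 0. [:- z, 1:])) = card {z. poly p z = 0}"
    by (simp add: degree_prod_sum_eq)
  then show ?thesis
    by (simp add: complex_poly_decompose_rsquarefree[OF assms])
qed

text \<open>A fibre off the branch locus contains no critical point, so all n + 1 roots of its fibre
  polynomial are simple.\<close>

lemma f_map_topological_degree:
  assumes "n \<ge> 2"
  shows "has_topological_degree (f_map n l) (n + 1)"
  unfolding has_topological_degree_def
proof (intro conjI allI impI)
  \<comment> \<open>On the line x = 0 the Jacobian determinant is y^n, so the only critical point
    there is the origin, which maps to the origin.\<close>
  have "vector [0, 1] \<notin> branch_locus (f_map n l)"
    using assms
    by (auto simp: branch_locus_def critical_locus_def f_map_jacobian_det vec_eq_iff forall_2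
        F_fun_def Q_fun_def power_0_left)
  then show "branch_locus (f_map n l) \<noteq> UNIV"
    by auto
next
  fix w assume w: "w \<notin> branch_locus (f_map n l)"
  let ?p = "fibre_poly n l w"
  have inj: "inj_on (\<lambda>y. vector [w $ 1, y] :: complex ^ 2) S" for S
    by (auto simp: inj_on_def vec_eq_iff forall_2)
  have "rsquarefree ?p"
    unfolding rsquarefree_roots
  proof (intro allI notI)
    fix y assume y: "poly ?p y = 0 \<and> poly (pderiv ?p) y = 0"
    then have "f_map n l (vector [w $ 1, y]) = w"
      by (simp add: vec_eq_iff forall_2 poly_fibre_poly)
    moreover have "vector [w $ 1, y] \<in> critical_locus (f_map n l)"
      using y by (simp add: critical_locus_def f_map_jacobian_det poly_pderiv_fibre_poly)
    ultimately show False
      using w unfolding branch_locus_def by (metis imageI)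
  qed
  then have "card {y. poly ?p y = 0} = n + 1"
    using assms by (simp add: card_roots_rsquarefree degree_fibre_poly)
  then show "card (f_map n l -` {w}) = n + 1"
    by (simp add: f_map_fibre card_image inj)
  have "?p \<noteq> 0"
    using degree_fibre_poly[OF assms, of l w] by auto
  then show "finite (f_map n l -` {w})"
    by (simp add: f_map_fibre poly_roots_finite)
qed

section \<open>Properness\<close>

lemma Q_fun_fibre_bound:
  assumes "n \<ge> 2" "norm x \<le> R" "norm (Q_fun n l x y) \<le> R"
  shows "norm y \<le> max 1 (real (n + 1) * (R + norm l / 2 * R ^ (n - 1) + R ^ n))"
proof (cases "norm y \<le> 1")
  case False
  let ?N = "R + norm l / 2 * R ^ (n - 1) + R ^ n"
  have R: "R \<ge> 0"
    using assms(2) norm_ge_zero order_trans by blast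
  \<comment> \<open>For |y| > 1 these inequalities bound every term other than y^(n+1)/(n+1) by a
    constant times |y|^2; since n + 1 \<ge> 3, cancelling |y|^2 then bounds |y|.\<close>
  have y2: "norm y \<le> (norm y)\<^sup>2" "1 \<le> (norm y)\<^sup>2"
    using False by (auto intro: self_le_power one_le_power)
  have "(norm y) ^ (n + 1) / real (n + 1) = norm (1 / of_nat (n + 1) * y ^ (n + 1))"
    by (simp add: norm_mult norm_divide norm_power del: of_nat_Suc)
  also have "1 / of_nat (n + 1) * y ^ (n + 1) =
      Q_fun n l x y - l / 2 * x ^ (n - 1) * y\<^sup>2 - x ^ n * y"
    by (simp add: Q_fun_def)
  also have "norm \<dots> \<le> norm (Q_fun n l x y) + norm (l / 2 * x ^ (n - 1) * y\<^sup>2) + norm (x ^ n * y)"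
    by (intro norm_triangle_le_diff add_mono order_refl)
  also have "\<dots> = norm (Q_fun n l x y) + norm l / 2 * norm x ^ (n - 1) * (norm y)\<^sup>2 + norm x ^ n * norm y"
    by (simp add: norm_mult norm_power norm_divide)
  also have "\<dots> \<le> R * (norm y)\<^sup>2 + norm l / 2 * R ^ (n - 1) * (norm y)\<^sup>2 + R ^ n * (norm y)\<^sup>2"
  proof (intro add_mono mult_mono power_mono)
    show "norm (Q_fun n l x y) \<le> R * (norm y)\<^sup>2"
      using assms(3) mult_left_mono[OF y2(2) R] by simp
  qed (use assms y2 R in auto)
  finally have "(norm y) ^ (n + 1) \<le> real (n + 1) * ?N * (norm y)\<^sup>2"
    by (simp add: field_simps)
  moreover have "(norm y) ^ 3 \<le> (norm y) ^ (n + 1)"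
    using False assms(1) by (intro power_increasing) auto
  ultimately have "norm y * (norm y)\<^sup>2 \<le> real (n + 1) * ?N * (norm y)\<^sup>2"
    by (simp add: power3_eq_cube power2_eq_square)
  then have "norm y \<le> real (n + 1) * ?N"
    by (rule mult_right_le_imp_le) (use y2 in linarith)
  then show ?thesis
    by simp
qed simp

text \<open>Preimages of compact sets are closed by continuity, and bounded because bounds on x and
  on the value of \<open>Q_fun\<close> bound y.\<close>

lemma proper_f_map:
  assumes "n \<ge> 2"
  shows "proper_polynomial_map (f_map n l)"
  unfolding proper_polynomial_map_def
proof (intro conjI allI impI)
  show pol: "polynomial_map (f_map n l)"
    using assms by (rule polynomial_map_f_map)
  show "dominant (f_map n l)"
    unfolding dominant_def
  proof (intro allI impI)
    fix p w assume "\<forall>v. p (f_map n l v) = (0 :: complex)"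
    moreover obtain v where "w = f_map n l v"
      using f_map_surj[OF assms] by (rule surjE)
    ultimately show "p w = 0"
      by simp
  qed
  fix K :: "(complex ^ 2) set" assume K: "compact K"
  obtain R where R: "\<And>w. w \<in> K \<Longrightarrow> norm w \<le> R"
    using compact_imp_bounded[OF K] by (auto simp: bounded_iff)
  let ?M = "max 1 (real (n + 1) * (R + norm l / 2 * R ^ (n - 1) + R ^ n))"
  have "norm v \<le> R + ?M" if "v \<in> f_map n l -` K" for v
  proof -
    have "norm (f_map n l v $ i) \<le> R" for i
      using R[of "f_map n l v"] that Finite_Cartesian_Product.norm_nth_le[of "f_map n l v" i] by simp
    from this[of 1] this[of 2] have "norm (v $ 1) \<le> R" "norm (v $ 2) \<le> ?M"
      using Q_fun_fibre_bound[OF assms] by (simp_all del: of_nat_add)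
    moreover have "norm v \<le> norm (v $ 1) + norm (v $ 2)"
      using L2_set_le_sum[of UNIV "\<lambda>i. norm (v $ i)"] by (simp add: norm_vec_def sum_2)
    ultimately show ?thesis
      by linarith
  qed
  then have "bounded (f_map n l -` K)"
    by (auto simp: bounded_iff)
  moreover have "closed (f_map n l -` K)"
    using K pol by (intro closed_vimage compact_imp_closed polynomial_map_continuous)
  ultimately show "compact (f_map n l -` K)"
    by (simp add: compact_eq_bounded_closed)
qed

section \<open>Exponential parameters and the continuous family\<close>

lemma exp_power_inject:
  fixes s t :: complex
  assumes "n \<ge> 1" "\<bar>Im s - Im t\<bar> < 2 * pi / real n" "exp s ^ n = exp t ^ n"
  shows "s = t"
proof -
  have e: "exp (of_nat n * s) = exp (of_nat n * t)"
    using assms(3) by (simp add: exp_of_nat_mult)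
  \<comment> \<open>Scaling by n turns the hypothesis into the condition that imaginary parts differ
    by less than 2 pi, where the exponential is injective.\<close>
  have "\<bar>Im (of_nat n * s) - Im (of_nat n * t)\<bar> = real n * \<bar>Im s - Im t\<bar>"
    by (simp add: abs_mult flip: right_diff_distrib)
  then have "\<bar>Im (of_nat n * s) - Im (of_nat n * t)\<bar> < 2 * pi"
    using assms(1,2) by (simp add: field_simps)
  from exp_complex_eqI[OF this e] have "of_nat n * s = of_nat n * t" .
  then show ?thesis
    using assms(1) by simp
qed

theorem theoremB1:
  fixes d :: nat
  assumes "d \<ge> 4"
  shows "(\<forall>l\<in>Gamma_set d. proper_polynomial_map (f_map d l)) \<and>
         (\<forall>l\<in>Gamma_set d. \<forall>m\<in>Gamma_set d.
            l ^ d \<noteq> m ^ d \<longrightarrow> \<not> equivalent_maps (f_map d l) (f_map d m)) \<and>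
         (\<exists>(U :: complex set) (g :: complex \<Rightarrow> complex ^ 2 \<Rightarrow> complex ^ 2).
            continuous_polynomial_family U g \<and>
            (\<forall>t\<in>U. proper_polynomial_map (g t) \<and> has_topological_degree (g t) d) \<and>
            (\<forall>s\<in>U. \<forall>t\<in>U. s \<noteq> t \<longrightarrow> \<not> equivalent_maps (g s) (g t)))"
proof (intro conjI)
  show "\<forall>l\<in>Gamma_set d. proper_polynomial_map (f_map d l)"
    using assms by (simp add: proper_f_map)
  show "\<forall>l\<in>Gamma_set d. \<forall>m\<in>Gamma_set d.
      l ^ d \<noteq> m ^ d \<longrightarrow> \<not> equivalent_maps (f_map d l) (f_map d m)"
  proof (intro ballI impI notI)
    fix l m assume *: "l \<in> Gamma_set d" "l ^ d \<noteq> m ^ d" "equivalent_maps (f_map d l) (f_map d m)"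
    have "nondegenerate d l"
      using *(1) assms by (intro Gamma_set_nondegenerate) auto
    from equivalent_f_maps_power_eq[OF _ this *(3)] show False
      using *(2) assms by simp
  qed
  \<comment> \<open>\<open>f_map n\<close> has topological degree n + 1, so the family of degree d
    uses n = d - 1; d \<ge> 4 provides the bound n \<ge> 3 for rigidity.\<close>
  define n where "n = d - 1"
  have n: "n \<ge> 3" "d = n + 1"
    using assms by (auto simp: n_def)
  \<comment> \<open>The centre makes |exp t| exceed n, which ensures nondegeneracy; the radius keeps
    the imaginary parts of two parameters less than 2/n apart, below the period 2 pi/n.\<close>
  define U :: "complex set" where "U = ball (of_nat n) (1 / real n)"
  define g where "g t = f_map n (exp t)" for t
  \<comment> \<open>The conditions in \<open>f_coeff\<close> compare exponents and do not involve t,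
    so continuity is checked branch by branch.\<close>
  have if_cont: "continuous_on U (\<lambda>t. if P then p t else q t)"
    if "continuous_on U p" "continuous_on U q" for P and p q :: "complex \<Rightarrow> complex ^ 2"
    using that by (cases P) simp_all
  have "continuous_on U (\<lambda>t. f_coeff n (exp t) \<alpha>)" for \<alpha>
  proof -
    have "continuous_on U (\<lambda>t. if i = 2 then exp t / 2 else 0)" for i :: 2
      by (cases "i = 2") (simp_all add: continuous_intros)
    then have "continuous_on U (\<lambda>t. axis (2 :: 2) (exp t / 2))"
      unfolding axis_def by (rule continuous_on_vec_lambda)
    then show ?thesis
      unfolding f_coeff_def by (intro if_cont continuous_on_const)
  qed
  then have family: "continuous_polynomial_family U g"
    unfolding continuous_polynomial_family_def g_def using n
    by (intro conjI exI[of _ "f_support n"] exI[of _ "\<lambda>\<alpha> t. f_coeff n (exp t) \<alpha>"])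
      (auto simp: U_def f_support_def f_map_expansion)
  have deg: "proper_polynomial_map (g t) \<and> has_topological_degree (g t) d" for t
    using n f_map_topological_degree[of n] by (simp add: g_def proper_f_map)
  have inequiv: "\<not> equivalent_maps (g s) (g t)" if "s \<in> U" "t \<in> U" "s \<noteq> t" for s t
  proof
    assume eqv: "equivalent_maps (g s) (g t)"
    have U: "\<bar>Re z - real n\<bar> < 1 / real n" "\<bar>Im z\<bar> < 1 / real n" if "z \<in> U" for z
      using that abs_Re_le_cmod[of "z - of_nat n"] abs_Im_le_cmod[of "z - of_nat n"]
      by (auto simp: U_def dist_norm norm_minus_commute)
    have "1 / real n \<le> 1"
      using n by simp
    \<comment> \<open>On \<open>U\<close> one has Re s > n - 1/n \<ge> n - 1, and 1 + Re s \<le> exp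
      (Re s) = |exp s|.\<close>
    then have "real n < 1 + Re s"
      using U(1)[OF that(1)] by linarith
    also have "\<dots> \<le> norm (exp s)"
      by simp
    finally have "nondegenerate n (exp s)"
      using n by (intro nondegenerate_if_large) auto
    then have powers: "exp t ^ n = exp s ^ n"
      using eqv n by (intro equivalent_f_maps_power_eq) (auto simp: g_def)
    have "\<bar>Im t - Im s\<bar> < 2 / real n"
      using U(2)[OF that(1)] U(2)[OF that(2)] by linarith
    also have "\<dots> \<le> 2 * pi / real n"
      using pi_gt3 by (intro divide_right_mono) simp_all
    finally have "t = s"
      using exp_power_inject[OF _ _ powers] n(1) by simp
    then show False
      using that by simp
  qed
  show "\<exists>(U :: complex set) (g :: complex \<Rightarrow> complex ^ 2 \<Rightarrow> complex ^ 2).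
      continuous_polynomial_family U g \<and>
      (\<forall>t\<in>U. proper_polynomial_map (g t) \<and> has_topological_degree (g t) d) \<and>
      (\<forall>s\<in>U. \<forall>t\<in>U. s \<noteq> t \<longrightarrow> \<not> equivalent_maps (g s) (g t))"
    using family deg inequiv by (intro exI[of _ U] exI[of _ g] conjI ballI impI) simp_all
qed

end
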